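(* Let $0<p<2$ and let $G$ be a graph of order $n\ge 2$ with Seidel matrix $S(G)$. Then $$\mathcal{E}_p(S(G)) \le n\,(n-1)^{\frac{p}{2}},$$ with equality if and only if $S(G)^2=(n-1)I$, that is, if and only if $S(G)$ is a symmetric conference matrix. Consequently, if a symmetric conference matrix of order $n$ exists, then $$\max_{|V(G)|=n}\mathcal{E}_p(S(G)) = n(n-1)^{\frac{p}{2}},$$ where the maximum is over all graphs $G$ of order $n$, and it is attained precisely by those graphs whose Seidel matrices are symmetric conference matrices. If no symmetric conference matrix of order $n$ exists, then $\mathcal{E}_p(S(G)) < n(n-1)^{\frac{p}{2}}$ for every graph $G$ of order $n$.
   Context: All graphs are finite, simple, undirected, non-empty and have at least one edge. The order of a graph is its number of vertices. For a graph $G$ with vertex set $\{v_1,\dots,v_n\}$, the Seidel matrix $S(G)$ is the real symmetric $n\times n$ matrix with zero diagonal whose $(i,j)$-entry, for $i\neq j$, is $-1$ if $v_i$ and $v_j$ are adjacent and $+1$ otherwise. If $\lambda_1,\dots,\lambda_n$ are the eigenvalues of $S(G)$ (with multiplicity), the $p$-Seidel energy is $\mathcal{E}_p(S(G))=\sum_{i=1}^n|\lambda_i|^p$ for $p>0$. A conference matrix of order $n$ is an $n\times n$ matrix $S$ with zero diagonal and off-diagonal entries $\pm1$ such that $SS^{\top}=(n-1)I$. $I$ denotes the identity matrix. *)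

theory Defs
  imports
    Complex_Main
    "HOL-Computational_Algebra.Fundamental_Theorem_Algebra"
    "Graph_Theory.Pair_Digraph"
    "Jordan_Normal_Form.Char_Poly"
begin

text \<open>
  An undirected edge $uv$ is represented by the two opposite arcs $(u,v)$ and $(v,u)$;
  \<^locale>\<open>pair_graph\<close> already requires finiteness, symmetry and the absence of loops.
\<close>

definition simple_graph :: "'a pair_pre_digraph \<Rightarrow> bool" where
  "simple_graph G \<longleftrightarrow> pair_graph G \<and> pverts G \<noteq> {} \<and> parcs G \<noteq> {}"

definition vertex_enum :: "'a pair_pre_digraph \<Rightarrow> 'a list \<Rightarrow> bool" where
  "vertex_enum G vs \<longleftrightarrow> distinct vs \<and> set vs = pverts G"

text \<open>The Seidel matrix depends on the numbering $v_1,\dots,v_n$ of the vertices, given as a list.\<close>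

definition seidel_matrix :: "'a pair_pre_digraph \<Rightarrow> 'a list \<Rightarrow> real mat" where
  "seidel_matrix G vs = mat (length vs) (length vs)
     (\<lambda>(i, j). if i = j then 0 else if (vs ! i, vs ! j) \<in> parcs G then -1 else 1)"

text \<open>
  The eigenvalues with algebraic multiplicity are taken over the complex numbers, so that no
  eigenvalue is lost for any square matrix; for a symmetric real matrix they are all real.
  Since \<^term>\<open>0 powr p = 0\<close>, zero eigenvalues contribute nothing, as intended for $p > 0$.
\<close>

definition spectrum_mset :: "real mat \<Rightarrow> complex multiset" where
  "spectrum_mset A = proots (char_poly (map_mat complex_of_real A))"

definition p_energy :: "real \<Rightarrow> real mat \<Rightarrow> real" where
  "p_energy p A = (\<Sum>z\<in>#spectrum_mset A. cmod z powr p)"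

definition conference_matrix :: "nat \<Rightarrow> real mat \<Rightarrow> bool" where
  "conference_matrix n S \<longleftrightarrow> S \<in> carrier_mat n n \<and>
     (\<forall>i<n. S $$ (i, i) = 0) \<and>
     (\<forall>i<n. \<forall>j<n. i \<noteq> j \<longrightarrow> S $$ (i, j) \<in> {-1, 1}) \<and>
     S * transpose_mat S = (real n - 1) \<cdot>\<^sub>m 1\<^sub>m n"

definition symmetric_conference_matrix :: "nat \<Rightarrow> real mat \<Rightarrow> bool" where
  "symmetric_conference_matrix n S \<longleftrightarrow> conference_matrix n S \<and> transpose_mat S = S"

text \<open>
  The values of the $p$-Seidel energy on all graphs of order $n$. Natural numbers serve as vertex
  names, which reaches every finite graph up to isomorphism.
\<close>

definition seidel_energies :: "real \<Rightarrow> nat \<Rightarrow> real set" where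
  "seidel_energies p n = {p_energy p (seidel_matrix G vs) | (G :: nat pair_pre_digraph) vs.
     simple_graph G \<and> card (pverts G) = n \<and> vertex_enum G vs}"

text \<open>There are infinitely many graphs on natural numbers, but only finitely many Seidel matrices
  of order $n$, so \<^const>\<open>Max\<close> may be applied to the set of energies.\<close>

lemma finite_seidel_energies: "finite (seidel_energies p n)"
proof -
  let ?F = "({..<n} \<times> {..<n}) \<rightarrow>\<^sub>E ({-1, 0, 1} :: real set)"
  have "seidel_energies p n \<subseteq> (\<lambda>f. p_energy p (mat n n f)) ` ?F"
  proof
    fix x assume "x \<in> seidel_energies p n"
    then obtain G :: "nat pair_pre_digraph" and vs where
      x: "x = p_energy p (seidel_matrix G vs)" and
      c: "card (pverts G) = n" "vertex_enum G vs"
      unfolding seidel_energies_def by blast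
    have len: "length vs = n"
      using c distinct_card unfolding vertex_enum_def by metis
    define f where "f = restrict (\<lambda>(i, j). if i = j then 0
      else if (vs ! i, vs ! j) \<in> parcs G then -1 else (1::real)) ({..<n} \<times> {..<n})"
    have "seidel_matrix G vs = mat n n f"
      unfolding seidel_matrix_def len by (rule eq_matI) (auto simp: f_def)
    moreover have "f \<in> ?F"
    proof (rule PiE_I)
      fix q assume "q \<in> {..<n} \<times> {..<n}"
      then show "f q \<in> {-1, 0, 1}"
        by (cases q) (simp add: f_def)
    qed (simp add: f_def)
    ultimately show "x \<in> (\<lambda>f. p_energy p (mat n n f)) ` ?F"
      unfolding x by (intro image_eqI[where x = f]) simp_all
  qed
  moreover have "finite ?F"
    by (intro finite_PiE) auto
  ultimately show ?thesis
    by (meson finite_imageI finite_subset)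
qed

end

theory Submission
  imports Defs "Jordan_Normal_Form.Schur_Decomposition"
begin

text \<open>
  A Seidel matrix $S$ of order $n$ is symmetric, so its eigenvalues are real, and
  $\sum |\lambda|^2$ is the trace of $S^2$, that is, the sum of the squares of the entries of $S$.
  This is $n(n-1)$ whatever the graph. Since $0 < p/2 < 1$, the function $x \mapsto x^{p/2}$ is
  strictly concave; hence among $n$ nonnegative numbers $|\lambda|^2$ with mean $n-1$ the sum of
  $|\lambda|^p$ is at most $n(n-1)^{p/2}$, with equality exactly when every $|\lambda|^2$ is $n-1$
  (\<open>sum_powr_le_mean\<close>).

  This equality case amounts to $S^2 = (n-1)I$, because for every $c$
  $$\sum (|\lambda|^2 - c)^2 = \mathrm{tr}\,(S^2 - cI)^2,$$
  and the right-hand side is the sum of the squares of the entries of $S^2 - cI$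
  (\<open>sum_squared_deviation_spectrum\<close>). One side vanishes if and only if the other does. All of
  these traces come from one fact, that the trace of $A^k$ is the sum of the $k$-th powers of the
  eigenvalues of $A$ (\<open>sum_diag_pow_eq_sum_proots\<close>).

  For the maximum, a symmetric conference matrix must be realised by a graph that has an edge.
  Its entries $-1$ are taken as the edges; if the entry at $(0,1)$ is not $-1$, the matrix is negated
  first, which keeps it a symmetric conference matrix
  (\<open>seidel_matrix_of_conference_matrix\<close>).
\<close>

section \<open>Sums of powers of eigenvalues\<close>

lemma upper_triangular_mult:
  fixes A B :: "'a :: semiring_0 mat"
  assumes A: "A \<in> carrier_mat n n" and B: "B \<in> carrier_mat n n"
    and "upper_triangular A" "upper_triangular B"
  shows "upper_triangular (A * B)"
    and "i < n \<Longrightarrow> (A * B) $$ (i, i) = A $$ (i, i) * B $$ (i, i)"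
proof -
  have A0: "A $$ (i, k) = 0" if "k < i" "i < n" for i k
    using that A assms(3) by auto
  have B0: "B $$ (k, j) = 0" if "j < k" "k < n" for j k
    using that B assms(4) by auto
  have entry: "(A * B) $$ (i, j) = (\<Sum>k<n. A $$ (i, k) * B $$ (k, j))"
    if "i < n" "j < n" for i j
    using that A B by (auto simp: scalar_prod_def lessThan_atLeast0 intro!: sum.cong)
  show "upper_triangular (A * B)"
  proof (rule upper_triangularI)
    fix i j assume *: "j < i" "i < dim_row (A * B)"
    then have "A $$ (i, k) * B $$ (k, j) = 0" if "k < n" for k
      using A0[of k i] B0[of j k] that A by (cases "k < i") auto
    then show "(A * B) $$ (i, j) = 0"
      using * A by (subst entry) auto
  qed
  show "(A * B) $$ (i, i) = A $$ (i, i) * B $$ (i, i)" if "i < n"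
  proof -
    have "A $$ (i, k) * B $$ (k, i) = 0" if "k \<in> {..<n} - {i}" for k
      using A0[of k i] B0[of i k] that \<open>i < n\<close> by (cases "k < i") auto
    then show ?thesis
      using that by (subst entry) (simp_all add: sum.remove[of "{..<n}" i])
  qed
qed

lemma upper_triangular_pow:
  fixes A :: "'a :: comm_semiring_1 mat"
  assumes A: "A \<in> carrier_mat n n" and ut: "upper_triangular A"
  shows "upper_triangular (A ^\<^sub>m k)"
    and "i < n \<Longrightarrow> (A ^\<^sub>m k) $$ (i, i) = A $$ (i, i) ^ k"
proof -
  have "upper_triangular (A ^\<^sub>m k) \<and> (\<forall>i<n. (A ^\<^sub>m k) $$ (i, i) = A $$ (i, i) ^ k)"
  proof (induction k)
    case (Suc k)
    have "A ^\<^sub>m k \<in> carrier_mat n n" using A by simp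
    with upper_triangular_mult[OF this A] Suc ut show ?case
      by (simp add: mult.commute)
  qed (use A in auto)
  then show "upper_triangular (A ^\<^sub>m k)"
    and "i < n \<Longrightarrow> (A ^\<^sub>m k) $$ (i, i) = A $$ (i, i) ^ k" by auto
qed

lemma sum_diag_mult:
  fixes A B :: "'a :: semiring_0 mat"
  assumes "A \<in> carrier_mat n m" "B \<in> carrier_mat m n"
  shows "(\<Sum>i<n. (A * B) $$ (i, i)) = (\<Sum>i<n. \<Sum>j<m. A $$ (i, j) * B $$ (j, i))"
  using assms by (auto simp: scalar_prod_def lessThan_atLeast0 intro!: sum.cong)

lemma sum_diag_mult_commute:
  fixes A B :: "'a :: comm_semiring_0 mat"
  assumes A: "A \<in> carrier_mat n m" and B: "B \<in> carrier_mat m n"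
  shows "(\<Sum>i<n. (A * B) $$ (i, i)) = (\<Sum>i<m. (B * A) $$ (i, i))"
  unfolding sum_diag_mult[OF A B] sum_diag_mult[OF B A]
  by (subst sum.swap) (simp add: mult.commute)

text \<open>
  Conjugation changes neither the trace nor the characteristic polynomial, so the matrix may be
  replaced by its Schur form, where the diagonal of a power is the power of the diagonal.
\<close>

lemma sum_diag_pow_eq_sum_proots:
  fixes A :: "complex mat"
  assumes A: "A \<in> carrier_mat n n"
  shows "(\<Sum>i<n. (A ^\<^sub>m k) $$ (i, i)) = (\<Sum>z\<in>#proots (char_poly A). z ^ k)"
proof -
  obtain as where as: "char_poly A = (\<Prod>a\<leftarrow>as. [:- a, 1:])"
    using char_poly_factorized[OF A] by blast
  obtain B P Q where "schur_decomposition A as = (B, P, Q)"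
    by (cases "schur_decomposition A as")
  from schur_decomposition[OF A as this]
  have sim: "similar_mat_wit A B P Q" and ut: "upper_triangular B" and diag: "diag_mat B = as"
    by auto
  from similar_mat_witD2[OF A sim]
  have QP: "Q * P = 1\<^sub>m n" and carr: "B \<in> carrier_mat n n" "P \<in> carrier_mat n n" "Q \<in> carrier_mat n n"
    by auto
  have Bk: "B ^\<^sub>m k \<in> carrier_mat n n" using carr by simp
  have "(\<Sum>i<n. (A ^\<^sub>m k) $$ (i, i)) = (\<Sum>i<n. ((P * B ^\<^sub>m k) * Q) $$ (i, i))"
    using similar_mat_wit_pow_id[OF sim] by simp
  also have "\<dots> = (\<Sum>i<n. (Q * (P * B ^\<^sub>m k)) $$ (i, i))"
    using carr Bk by (intro sum_diag_mult_commute) auto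
  also have "Q * (P * B ^\<^sub>m k) = B ^\<^sub>m k"
    using assoc_mult_mat[OF carr(3,2) Bk] QP left_mult_one_mat[OF Bk] by simp
  also have "(\<Sum>i<n. (B ^\<^sub>m k) $$ (i, i)) = (\<Sum>i<n. B $$ (i, i) ^ k)"
    using upper_triangular_pow(2)[OF carr(1) ut] by simp
  also have "\<dots> = (\<Sum>a\<leftarrow>as. a ^ k)"
    using carr by (simp add: diag[symmetric] diag_mat_def comp_def
        interv_sum_list_conv_sum_set_nat atLeast0LessThan)
  also have "\<dots> = (\<Sum>z\<in>#mset as. z ^ k)"
    by (simp flip: sum_mset_sum_list)
  also have "mset as = proots (char_poly A)"
  proof -
    have "proots (\<Prod>a\<leftarrow>as. [:- a, 1:]) = mset as"
      by (induction as) (simp_all add: proots_mult prod_list_zero_iff image_iff del: mult_pCons_left)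
    then show ?thesis by (simp add: as)
  qed
  finally show ?thesis .
qed

lemma size_spectrum_mset:
  assumes "A \<in> carrier_mat n n"
  shows "size (spectrum_mset A) = n"
proof -
  have "map_mat complex_of_real A \<in> carrier_mat n n" using assms by simp
  from degree_monic_char_poly[OF this] show ?thesis
    by (simp add: spectrum_mset_def size_proots_complex)
qed

text \<open>
  If $Av = zv$ then $A\bar v = \bar z \bar v$, as $A$ is real. Moving the symmetric $A$ from one
  factor of $v \cdot \bar v$ to the other gives $z = \bar z$, as $v \cdot \bar v \neq 0$.
\<close>

lemma spectrum_symmetric_real:
  fixes A :: "real mat"
  assumes A: "A \<in> carrier_mat n n" and sym: "transpose_mat A = A"
    and z: "z \<in># spectrum_mset A"
  shows "z \<in> \<real>"
proof -
  let ?A = "map_mat complex_of_real A"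
  have cA: "?A \<in> carrier_mat n n" using A by simp
  have "char_poly ?A \<noteq> 0"
    using degree_monic_char_poly[OF cA] by auto
  then have "poly (char_poly ?A) z = 0"
    using z unfolding spectrum_mset_def by (simp add: set_count_proots)
  then obtain v where v: "v \<in> carrier_vec n" "v \<noteq> 0\<^sub>v n" and ev: "?A *\<^sub>v v = z \<cdot>\<^sub>v v"
    using eigenvalue_root_char_poly[OF cA] cA unfolding eigenvalue_def eigenvector_def by auto
  have cv: "conjugate v \<in> carrier_vec n" using v by simp
  have conj: "?A *\<^sub>v conjugate v = cnj z \<cdot>\<^sub>v conjugate v"
  proof -
    have "?A *\<^sub>v conjugate v = conjugate (?A *\<^sub>v v)"
      using A v by (intro eq_vecI) (auto simp: scalar_prod_def)
    then show ?thesis by (simp add: ev conjugate_smult_vec)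
  qed
  have symA: "transpose_mat ?A = ?A"
    using sym A by (metis map_mat_transpose)
  have "z * (v \<bullet>c v) = (?A *\<^sub>v v) \<bullet>c v"
    using v cv by (simp add: ev)
  also have "\<dots> = v \<bullet> (?A *\<^sub>v conjugate v)"
    using transpose_vec_mult_scalar[OF cA v(1) cv] symA v cv cA
    by (simp add: comm_scalar_prod[of _ n])
  also have "\<dots> = cnj z * (v \<bullet>c v)"
    using v cv by (simp add: conj)
  finally have "z = cnj z" using v by simp
  then show ?thesis by (metis Reals_cnj_iff)
qed

text \<open>
  The energy is built from absolute values, the trace from the eigenvalues themselves. For even
  exponents and real eigenvalues the two agree.
\<close>

lemma sum_even_powers_spectrum:
  fixes A :: "real mat"
  assumes A: "A \<in> carrier_mat n n" and sym: "transpose_mat A = A" and k: "even k"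
  shows "(\<Sum>z\<in>#spectrum_mset A. cmod z ^ k) = (\<Sum>i<n. (A ^\<^sub>m k) $$ (i, i))"
proof -
  have "complex_of_real (\<Sum>z\<in>#spectrum_mset A. cmod z ^ k)
      = (\<Sum>z\<in>#spectrum_mset A. complex_of_real (cmod z ^ k))"
    by (simp add: multiset.map_comp comp_def)
  also have "\<dots> = (\<Sum>z\<in>#spectrum_mset A. z ^ k)"
  proof (intro arg_cong[of _ _ sum_mset] image_mset_cong)
    fix z assume "z \<in># spectrum_mset A"
    then obtain x where "z = of_real x"
      using spectrum_symmetric_real[OF A sym] by (auto elim: Reals_cases)
    then show "complex_of_real (cmod z ^ k) = z ^ k"
      using k by (simp add: power_even_abs flip: of_real_power)
  qed
  also have "\<dots> = (\<Sum>i<n. (map_mat complex_of_real A ^\<^sub>m k) $$ (i, i))"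
    using A sum_diag_pow_eq_sum_proots[of "map_mat complex_of_real A" n k]
    by (simp add: spectrum_mset_def)
  also have "map_mat complex_of_real A ^\<^sub>m k = map_mat complex_of_real (A ^\<^sub>m k)"
    by (rule of_real_hom.mat_hom_pow[OF A, symmetric])
  also have "(\<Sum>i<n. map_mat complex_of_real (A ^\<^sub>m k) $$ (i, i))
      = complex_of_real (\<Sum>i<n. (A ^\<^sub>m k) $$ (i, i))"
    using A by simp
  finally show ?thesis by (simp only: of_real_eq_iff)
qed

lemma pow_mat_2: "A \<in> carrier_mat n n \<Longrightarrow> A ^\<^sub>m 2 = A * A"
  by (simp add: numeral_2_eq_2)

lemma pow_mat_4:
  assumes A: "A \<in> carrier_mat n n"
  shows "A ^\<^sub>m 4 = A ^\<^sub>m 2 * A ^\<^sub>m 2"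
  using A by (simp add: numeral_eq_Suc assoc_mult_mat[of _ n n _ n _ n])

text \<open>
  With $B = A^2$, expanding the square on the left leaves the traces of $B^2$, $B$ and $I$. Because
  $B$ is symmetric, the trace of $B^2$ is the sum of the squares of its entries; on the right, only
  the diagonal entries meet the multiple of the identity.
\<close>

lemma sum_squared_deviation_spectrum:
  fixes A :: "real mat"
  assumes A: "A \<in> carrier_mat n n" and sym: "transpose_mat A = A"
  shows "(\<Sum>z\<in>#spectrum_mset A. ((cmod z)\<^sup>2 - c)\<^sup>2)
    = (\<Sum>i<n. \<Sum>j<n. ((A ^\<^sub>m 2 - c \<cdot>\<^sub>m 1\<^sub>m n) $$ (i, j))\<^sup>2)"
proof -
  let ?B = "A ^\<^sub>m 2"
  have B: "?B \<in> carrier_mat n n" using A by simp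
  have "transpose_mat ?B = ?B"
    using A by (simp add: pow_mat_2 transpose_mult[OF A A] sym)
  then have symB: "?B $$ (j, i) = ?B $$ (i, j)" if "i < n" "j < n" for i j
    using that B by (metis carrier_matD index_transpose_mat(1))
  have "(\<Sum>z\<in>#spectrum_mset A. ((cmod z)\<^sup>2 - c)\<^sup>2)
      = (\<Sum>z\<in>#spectrum_mset A. cmod z ^ 4 + (- 2 * c) * (cmod z)\<^sup>2 + c\<^sup>2)"
    by (intro arg_cong[of _ _ sum_mset] image_mset_cong) (simp add: power2_eq_square power4_eq_xxxx algebra_simps)
  also have "\<dots> = (\<Sum>z\<in>#spectrum_mset A. cmod z ^ 4)
      + (- 2 * c) * (\<Sum>z\<in>#spectrum_mset A. (cmod z)\<^sup>2) + real n * c\<^sup>2"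
    by (simp only: sum_mset.distrib sum_mset_distrib_left[symmetric] sum_mset_constant
        size_spectrum_mset[OF A])
  also have "(\<Sum>z\<in>#spectrum_mset A. cmod z ^ 4) = (\<Sum>i<n. (?B * ?B) $$ (i, i))"
    by (simp add: sum_even_powers_spectrum[OF A sym] pow_mat_4[OF A])
  also have "\<dots> = (\<Sum>i<n. \<Sum>j<n. (?B $$ (i, j))\<^sup>2)"
    unfolding sum_diag_mult[OF B B] by (intro sum.cong refl) (auto simp: power2_eq_square symB)
  also have "(\<Sum>z\<in>#spectrum_mset A. (cmod z)\<^sup>2) = (\<Sum>i<n. ?B $$ (i, i))"
    by (simp add: sum_even_powers_spectrum[OF A sym])
  also have "(\<Sum>i<n. \<Sum>j<n. (?B $$ (i, j))\<^sup>2) + (- 2 * c) * (\<Sum>i<n. ?B $$ (i, i)) + real n * c\<^sup>2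
      = (\<Sum>i<n. (\<Sum>j<n. (?B $$ (i, j))\<^sup>2) + (- 2 * c) * ?B $$ (i, i) + c\<^sup>2)"
    by (simp only: sum.distrib sum_distrib_left sum_constant card_lessThan)
  also have "\<dots> = (\<Sum>i<n. \<Sum>j<n. ((?B - c \<cdot>\<^sub>m 1\<^sub>m n) $$ (i, j))\<^sup>2)"
  proof (intro sum.cong refl)
    fix i assume i: "i \<in> {..<n}"
    have "(\<Sum>j<n. ((?B - c \<cdot>\<^sub>m 1\<^sub>m n) $$ (i, j))\<^sup>2)
       = (\<Sum>j<n. (?B $$ (i, j))\<^sup>2 + (if j = i then (- 2 * c) * ?B $$ (i, i) + c\<^sup>2 else 0))"
      using i B by (intro sum.cong refl) (auto simp: power2_eq_square algebra_simps)
    then show "(\<Sum>j<n. (?B $$ (i, j))\<^sup>2) + (- 2 * c) * ?B $$ (i, i) + c\<^sup>2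
        = (\<Sum>j<n. ((?B - c \<cdot>\<^sub>m 1\<^sub>m n) $$ (i, j))\<^sup>2)"
      using i by (simp add: sum.distrib)
  qed
  finally show ?thesis .
qed

lemma sum_mset_nonneg:
  fixes f :: "'a \<Rightarrow> real"
  assumes "\<And>x. x \<in># M \<Longrightarrow> 0 \<le> f x"
  shows "0 \<le> (\<Sum>x\<in>#M. f x)"
  using assms by (induction M) auto

lemma sum_mset_nonneg_eq_0_iff:
  fixes f :: "'a \<Rightarrow> real"
  assumes "\<And>x. x \<in># M \<Longrightarrow> 0 \<le> f x"
  shows "(\<Sum>x\<in>#M. f x) = 0 \<longleftrightarrow> (\<forall>x\<in>#M. f x = 0)"
  using assms
proof (induction M)
  case (add a M)
  have "0 \<le> (\<Sum>x\<in>#M. f x)" using add.prems by (intro sum_mset_nonneg) auto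
  with add show ?case by (auto simp: add_nonneg_eq_0_iff)
qed auto

lemma spectrum_constant_modulus_iff:
  fixes A :: "real mat"
  assumes A: "A \<in> carrier_mat n n" and sym: "transpose_mat A = A"
  shows "(\<forall>z\<in>#spectrum_mset A. (cmod z)\<^sup>2 = c) \<longleftrightarrow> A ^\<^sub>m 2 = c \<cdot>\<^sub>m 1\<^sub>m n"
proof -
  have B: "A ^\<^sub>m 2 \<in> carrier_mat n n" using A by simp
  have "(\<forall>z\<in>#spectrum_mset A. (cmod z)\<^sup>2 = c)
      \<longleftrightarrow> (\<Sum>z\<in>#spectrum_mset A. ((cmod z)\<^sup>2 - c)\<^sup>2) = 0"
    by (subst sum_mset_nonneg_eq_0_iff) auto
  also have "\<dots> \<longleftrightarrow> (\<forall>i<n. \<forall>j<n. (A ^\<^sub>m 2 - c \<cdot>\<^sub>m 1\<^sub>m n) $$ (i, j) = 0)"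
    unfolding sum_squared_deviation_spectrum[OF A sym]
    by (auto simp: sum_nonneg_eq_0_iff sum_nonneg)
  also have "\<dots> \<longleftrightarrow> A ^\<^sub>m 2 = c \<cdot>\<^sub>m 1\<^sub>m n"
  proof
    assume *: "\<forall>i<n. \<forall>j<n. (A ^\<^sub>m 2 - c \<cdot>\<^sub>m 1\<^sub>m n) $$ (i, j) = 0"
    show "A ^\<^sub>m 2 = c \<cdot>\<^sub>m 1\<^sub>m n"
    proof (rule eq_matI)
      fix i j assume "i < dim_row (c \<cdot>\<^sub>m 1\<^sub>m n)" "j < dim_col (c \<cdot>\<^sub>m 1\<^sub>m n)"
      with *[rule_format, of i j] show "(A ^\<^sub>m 2) $$ (i, j) = (c \<cdot>\<^sub>m 1\<^sub>m n) $$ (i, j)" 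
        using B by simp
    qed (use B in auto)
  qed auto
  finally show ?thesis .
qed

section \<open>The power mean inequality\<close>

text \<open>
  A strict form of Bernoulli's inequality. With $w = 1 + q(t-1)$, a convex combination of $t$ and
  $1$, it says $q \ln t < \ln w$; this is the combination with weights $q$ and $1-q$ of
  $\ln x \le x - 1$ at $x = t/w$ and $x = 1/w$, whose right-hand sides cancel. It is strict
  because $w \neq 1$.
\<close>

lemma powr_less_tangent_1:
  fixes t q :: real
  assumes q: "0 < q" "q < 1" and t: "0 \<le> t" "t \<noteq> 1"
  shows "t powr q < 1 + q * (t - 1)"
proof (cases "t = 0")
  case False
  define w where "w = 1 + q * (t - 1)"
  have tq: "0 < q * t" using False t q by simp
  have w: "0 < w" using tq q by (simp add: w_def algebra_simps)
  have "w \<noteq> 1" using q t by (simp add: w_def)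
  then have "ln (1 / w) < 1 / w - 1"
    using ln_le_minus_one[of "1 / w"] ln_eq_minus_one[of "1 / w"] w by fastforce
  moreover have "ln (t / w) \<le> t / w - 1"
    using w t False by (intro ln_le_minus_one) simp
  ultimately have "q * ln (t / w) + (1 - q) * ln (1 / w) < q * (t / w - 1) + (1 - q) * (1 / w - 1)"
    using q by (intro add_le_less_mono mult_left_mono mult_strict_left_mono) auto
  also have "\<dots> = 0" using w by (simp add: w_def field_simps)
  finally have "q * ln t < ln w"
    using w t False by (simp add: ln_div algebra_simps)
  then have "exp (q * ln t) < exp (ln w)" by simp
  then show ?thesis
    using w False by (simp add: powr_def flip: w_def)
qed (use q in simp)

lemma powr_less_tangent:
  fixes x c q :: real
  assumes q: "0 < q" "q < 1" and c: "0 < c" and x: "0 \<le> x" "x \<noteq> c"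
  shows "x powr q < c powr q + q * c powr q / c * (x - c)"
proof -
  have "(x / c) powr q < 1 + q * (x / c - 1)"
    using assms by (intro powr_less_tangent_1) auto
  then have "c powr q * (x / c) powr q < c powr q * (1 + q * (x / c - 1))"
    using c by simp
  moreover have "c powr q * (x / c) powr q = x powr q"
    using c x by (simp add: powr_divide)
  ultimately show ?thesis using c by (simp add: field_simps)
qed

text \<open>
  The power function lies below its tangent at the mean $c$, and the linear terms of the tangents
  sum to zero. The gaps \<open>g\<close> between tangent and function are nonnegative and vanish only
  at $c$, which settles the equality case.
\<close>

lemma sum_powr_le_mean:
  fixes f :: "'a \<Rightarrow> real"
  assumes q: "0 < q" "q < 1" and c: "0 < c" and f: "\<And>x. x \<in># M \<Longrightarrow> 0 \<le> f x"
    and mean: "(\<Sum>x\<in>#M. f x) = real (size M) * c"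
  shows "(\<Sum>x\<in>#M. f x powr q) \<le> real (size M) * c powr q"
    and "(\<Sum>x\<in>#M. f x powr q) = real (size M) * c powr q \<longleftrightarrow> (\<forall>x\<in>#M. f x = c)"
proof -
  define g where "g x = c powr q + q * c powr q / c * (f x - c) - f x powr q" for x
  have g0: "0 \<le> g x \<and> (g x = 0 \<longleftrightarrow> f x = c)" if "x \<in># M" for x
    using powr_less_tangent[OF q c f[OF that]] by (cases "f x = c") (auto simp: g_def)
  have "(\<Sum>x\<in>#M. g x) + (\<Sum>x\<in>#M. f x powr q) 
     = (\<Sum>x\<in>#M. c powr q - q * c powr q + q * c powr q / c * f x)"
    using c by (simp flip: sum_mset.distrib add: g_def field_simps)
  also have "\<dots> = real (size M) * (c powr q - q * c powr q) + q * c powr q / c * (real (size M) * c)"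
    by (simp only: sum_mset.distrib sum_mset_distrib_left[symmetric] sum_mset_constant mean)
  also have "\<dots> = real (size M) * c powr q" using c by (simp add: field_simps)
  finally have eq: "(\<Sum>x\<in>#M. g x) + (\<Sum>x\<in>#M. f x powr q) = real (size M) * c powr q" .
  have "0 \<le> (\<Sum>x\<in>#M. g x)" using g0 by (intro sum_mset_nonneg) auto
  with eq show "(\<Sum>x\<in>#M. f x powr q) \<le> real (size M) * c powr q" by simp
  have "(\<Sum>x\<in>#M. f x powr q) = real (size M) * c powr q \<longleftrightarrow> (\<Sum>x\<in>#M. g x) = 0"
    using eq by linarith
  also have "\<dots> \<longleftrightarrow> (\<forall>x\<in>#M. g x = 0)" using g0 by (intro sum_mset_nonneg_eq_0_iff) auto
  finally show "(\<Sum>x\<in>#M. f x powr q) = real (size M) * c powr q \<longleftrightarrow> (\<forall>x\<in>#M. f x = c)"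
    using g0 by auto
qed

lemma p_energy_le:
  fixes A :: "real mat"
  assumes p: "0 < p" "p < 2" and c: "0 < c"
    and A: "A \<in> carrier_mat n n" and sym: "transpose_mat A = A"
    and frob: "(\<Sum>i<n. \<Sum>j<n. (A $$ (i, j))\<^sup>2) = real n * c"
  shows "p_energy p A \<le> real n * c powr (p / 2)"
    and "p_energy p A = real n * c powr (p / 2) \<longleftrightarrow> A ^\<^sub>m 2 = c \<cdot>\<^sub>m 1\<^sub>m n"
proof -
  have energy: "p_energy p A = (\<Sum>z\<in>#spectrum_mset A. (cmod z)\<^sup>2 powr (p / 2))"
    unfolding p_energy_def by (simp add: powr_powr flip: powr_numeral)
  have symA: "A $$ (j, i) = A $$ (i, j)" if "i < n" "j < n" for i j
    using that A sym by (metis carrier_matD index_transpose_mat(1))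
  have "(\<Sum>z\<in>#spectrum_mset A. (cmod z)\<^sup>2) = (\<Sum>i<n. (A * A) $$ (i, i))"
    by (simp add: sum_even_powers_spectrum[OF A sym] pow_mat_2[OF A])
  also have "\<dots> = (\<Sum>i<n. \<Sum>j<n. (A $$ (i, j))\<^sup>2)"
    unfolding sum_diag_mult[OF A A] by (intro sum.cong refl) (auto simp: power2_eq_square symA)
  finally have mean: "(\<Sum>z\<in>#spectrum_mset A. (cmod z)\<^sup>2) = real (size (spectrum_mset A)) * c"
    by (simp add: frob size_spectrum_mset[OF A])
  have q: "0 < p / 2" "p / 2 < 1" using p by auto
  note power_mean = sum_powr_le_mean[OF q c _ mean, unfolded size_spectrum_mset[OF A]]
  show "p_energy p A \<le> real n * c powr (p / 2)"
    unfolding energy by (rule power_mean) simp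
  show "p_energy p A = real n * c powr (p / 2) \<longleftrightarrow> A ^\<^sub>m 2 = c \<cdot>\<^sub>m 1\<^sub>m n"
    unfolding energy spectrum_constant_modulus_iff[OF A sym, symmetric]
    by (rule power_mean) simp
qed

section \<open>Seidel matrices\<close>

lemma seidel_matrix_props:
  assumes G: "simple_graph G" and n: "card (pverts G) = n" and vs: "vertex_enum G vs"
  shows "seidel_matrix G vs \<in> carrier_mat n n"
    and "transpose_mat (seidel_matrix G vs) = seidel_matrix G vs"
    and "i < n \<Longrightarrow> seidel_matrix G vs $$ (i, i) = 0"
    and "i < n \<Longrightarrow> j < n \<Longrightarrow> i \<noteq> j \<Longrightarrow> seidel_matrix G vs $$ (i, j) \<in> {-1, 1}"
proof -
  interpret pair_graph G using G by (simp add: simple_graph_def)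
  have len: "length vs = n"
    using n vs distinct_card unfolding vertex_enum_def by metis
  have "(u, v) \<in> parcs G \<longleftrightarrow> (v, u) \<in> parcs G" for u v
    using pair_sym_arcs unfolding symmetric_def sym_def by auto
  then show "transpose_mat (seidel_matrix G vs) = seidel_matrix G vs"
    by (intro eq_matI) (auto simp: seidel_matrix_def len)
qed (use n vs distinct_card[of vs] in \<open>auto simp: seidel_matrix_def vertex_enum_def\<close>)

lemma sum_squares_seidel_matrix:
  assumes "simple_graph G" "card (pverts G) = n" "vertex_enum G vs"
  shows "(\<Sum>i<n. \<Sum>j<n. (seidel_matrix G vs $$ (i, j))\<^sup>2) = real n * (real n - 1)"
proof -
  note S = seidel_matrix_props[OF assms]
  have "(\<Sum>j<n. (seidel_matrix G vs $$ (i, j))\<^sup>2) = real n - 1" if i: "i < n" for i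
  proof -
    have "(seidel_matrix G vs $$ (i, j))\<^sup>2 = (if j = i then 0 else 1)" if "j < n" for j
      using S(3)[OF i] S(4)[OF i that] by auto
    then have "(\<Sum>j<n. (seidel_matrix G vs $$ (i, j))\<^sup>2) = (\<Sum>j<n. if j = i then 0 else 1)"
      by (intro sum.cong) auto
    also have "\<dots> = (\<Sum>j\<in>{..<n} - {i}. 1)"
      using i by (simp add: sum.remove[of "{..<n}" i])
    finally show ?thesis using i by (simp add: of_nat_diff)
  qed
  then show ?thesis by simp
qed

lemma seidel_conference_iff:
  assumes "simple_graph G" "card (pverts G) = n" "vertex_enum G vs"
  shows "seidel_matrix G vs ^\<^sub>m 2 = (real n - 1) \<cdot>\<^sub>m 1\<^sub>m n \<longleftrightarrow>
    symmetric_conference_matrix n (seidel_matrix G vs)"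
  using seidel_matrix_props[OF assms]
  by (auto simp: symmetric_conference_matrix_def conference_matrix_def pow_mat_2)

lemma symmetric_conference_matrix_uminus:
  assumes "symmetric_conference_matrix n S"
  shows "symmetric_conference_matrix n (- S)"
proof -
  have S: "S \<in> carrier_mat n n" and "transpose_mat S = S"
    and SS: "S * S = (real n - 1) \<cdot>\<^sub>m 1\<^sub>m n"
    using assms by (auto simp: symmetric_conference_matrix_def conference_matrix_def)
  then have sym: "transpose_mat (- S) = - S"
    by (metis transpose_uminus)
  have "- S * - S = S * S" using S by simp
  then have "- S * transpose_mat (- S) = (real n - 1) \<cdot>\<^sub>m 1\<^sub>m n"
    unfolding sym by (simp add: SS)
  moreover have "(- S) $$ (i, j) \<in> {-1, 1}" if "i < n" "j < n" "i \<noteq> j" for i j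
    using that assms S by (auto simp: symmetric_conference_matrix_def conference_matrix_def)
  ultimately show ?thesis using assms sym
    by (auto simp: symmetric_conference_matrix_def conference_matrix_def)
qed

text \<open>
  A graph must have an edge, and for $n = 2$ the conference matrix with both off-diagonal entries
  $1$ gives none. Choosing the sign of the matrix so that $(0,1)$ becomes an edge repairs this; it is
  harmless, since any graph attaining the maximum will do.
\<close>

lemma seidel_matrix_of_conference_matrix:
  assumes n: "2 \<le> n" and S: "symmetric_conference_matrix n S"
  obtains G :: "nat pair_pre_digraph" and vs where
    "simple_graph G" "card (pverts G) = n" "vertex_enum G vs"
    "symmetric_conference_matrix n (seidel_matrix G vs)"
proof -
  define T where "T = (if S $$ (0, 1) = -1 then S else - S)"
  have T: "symmetric_conference_matrix n T"
    unfolding T_def using S symmetric_conference_matrix_uminus[OF S] by simp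
  have "S $$ (0, 1) \<in> {-1, 1}" and "S \<in> carrier_mat n n"
    using S n by (auto simp: symmetric_conference_matrix_def conference_matrix_def)
  then have T01: "T $$ (0, 1) = -1" using n by (auto simp: T_def)
  have carr: "T \<in> carrier_mat n n" and Tt: "transpose_mat T = T"
    and diag: "\<And>i. i < n \<Longrightarrow> T $$ (i, i) = 0"
    and off: "\<And>i j. i < n \<Longrightarrow> j < n \<Longrightarrow> i \<noteq> j \<Longrightarrow> T $$ (i, j) \<in> {-1, 1}"
    using T by (auto simp: symmetric_conference_matrix_def conference_matrix_def)
  have symT: "T $$ (j, i) = T $$ (i, j)" if "i < n" "j < n" for i j
    using that carr Tt by (metis carrier_matD index_transpose_mat(1))
  define G where "G = \<lparr>pverts = {..<n}, parcs = {(i, j). i < n \<and> j < n \<and> T $$ (i, j) = -1}\<rparr>"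
  have "parcs G \<subseteq> {..<n} \<times> {..<n}" by (auto simp: G_def)
  then have "finite (parcs G)" by (rule finite_subset) simp
  then have "pair_graph G"
    using diag symT by unfold_locales (auto simp: G_def symmetric_def sym_def)
  moreover have "(0, 1) \<in> parcs G" using n T01 by (simp add: G_def)
  moreover have "0 \<in> pverts G" using n by (simp add: G_def)
  ultimately have "simple_graph G" by (auto simp: simple_graph_def)
  moreover have "card (pverts G) = n" by (simp add: G_def)
  moreover have "vertex_enum G [0..<n]" by (auto simp: vertex_enum_def G_def)
  moreover have "seidel_matrix G [0..<n] = T"
  proof (rule eq_matI)
    fix i j assume "i < dim_row T" "j < dim_col T"
    with carr have "i < n" "j < n" by auto
    with off[of i j] diag show "seidel_matrix G [0..<n] $$ (i, j) = T $$ (i, j)"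
      by (auto simp: seidel_matrix_def G_def)
  qed (use carr in \<open>auto simp: seidel_matrix_def\<close>)
  ultimately show ?thesis using T that by metis
qed

lemma seidel_energy_bound:
  assumes "0 < p" "p < 2" "2 \<le> n"
    and G: "simple_graph G" "card (pverts G) = n" "vertex_enum G vs"
  shows "p_energy p (seidel_matrix G vs) \<le> real n * (real n - 1) powr (p / 2)"
    and "p_energy p (seidel_matrix G vs) = real n * (real n - 1) powr (p / 2) \<longleftrightarrow>
      symmetric_conference_matrix n (seidel_matrix G vs)"
  using p_energy_le[OF assms(1,2) _ seidel_matrix_props(1,2)[OF G] sum_squares_seidel_matrix[OF G]]
    seidel_conference_iff[OF G] assms(3) by auto

lemma Max_seidel_energies:
  assumes p: "0 < p" "p < 2" and n: "2 \<le> n" and S: "symmetric_conference_matrix n S"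
  shows "Max (seidel_energies p n) = real n * (real n - 1) powr (p / 2)"
proof (rule Max_eqI)
  obtain G :: "nat pair_pre_digraph" and vs where
    G: "simple_graph G" "card (pverts G) = n" "vertex_enum G vs"
    and conf: "symmetric_conference_matrix n (seidel_matrix G vs)"
    using seidel_matrix_of_conference_matrix[OF n S] .
  have "real n * (real n - 1) powr (p / 2) = p_energy p (seidel_matrix G vs)"
    using seidel_energy_bound(2)[OF p n G] conf by simp
  with G show "real n * (real n - 1) powr (p / 2) \<in> seidel_energies p n"
    unfolding seidel_energies_def by blast
qed (use finite_seidel_energies seidel_energy_bound(1)[OF p n] in
    \<open>auto simp: seidel_energies_def\<close>)

theorem mainTheorem2:
  fixes p :: real and n :: nat
  assumes "0 < p" and "p < 2" and "2 \<le> n"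
  shows
    "(\<forall>(G :: 'a pair_pre_digraph) vs.
        simple_graph G \<and> card (pverts G) = n \<and> vertex_enum G vs \<longrightarrow>
          p_energy p (seidel_matrix G vs) \<le> real n * (real n - 1) powr (p / 2) \<and>
          (p_energy p (seidel_matrix G vs) = real n * (real n - 1) powr (p / 2) \<longleftrightarrow>
             seidel_matrix G vs ^\<^sub>m 2 = (real n - 1) \<cdot>\<^sub>m 1\<^sub>m n) \<and>
          (seidel_matrix G vs ^\<^sub>m 2 = (real n - 1) \<cdot>\<^sub>m 1\<^sub>m n \<longleftrightarrow>
             symmetric_conference_matrix n (seidel_matrix G vs)))
     \<and>
     ((\<exists>S. symmetric_conference_matrix n S) \<longrightarrow>
        Max (seidel_energies p n) = real n * (real n - 1) powr (p / 2) \<and>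
        (\<forall>(G :: 'a pair_pre_digraph) vs.
           simple_graph G \<and> card (pverts G) = n \<and> vertex_enum G vs \<longrightarrow>
             (p_energy p (seidel_matrix G vs) = Max (seidel_energies p n) \<longleftrightarrow>
                symmetric_conference_matrix n (seidel_matrix G vs))))
     \<and>
     ((\<nexists>S. symmetric_conference_matrix n S) \<longrightarrow>
        (\<forall>(G :: 'a pair_pre_digraph) vs.
           simple_graph G \<and> card (pverts G) = n \<and> vertex_enum G vs \<longrightarrow>
             p_energy p (seidel_matrix G vs) < real n * (real n - 1) powr (p / 2)))"
proof (intro conjI allI impI)
  fix G :: "'a pair_pre_digraph" and vs
  assume "simple_graph G \<and> card (pverts G) = n \<and> vertex_enum G vs"
  then have G: "simple_graph G" "card (pverts G) = n" "vertex_enum G vs" by auto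
  note bound = seidel_energy_bound[OF assms G]
  show "p_energy p (seidel_matrix G vs) \<le> real n * (real n - 1) powr (p / 2)"
    by (rule bound)
  show "p_energy p (seidel_matrix G vs) = real n * (real n - 1) powr (p / 2) \<longleftrightarrow>
      seidel_matrix G vs ^\<^sub>m 2 = (real n - 1) \<cdot>\<^sub>m 1\<^sub>m n"
    unfolding bound(2) seidel_conference_iff[OF G] ..
  show "seidel_matrix G vs ^\<^sub>m 2 = (real n - 1) \<cdot>\<^sub>m 1\<^sub>m n \<longleftrightarrow>
      symmetric_conference_matrix n (seidel_matrix G vs)"
    by (rule seidel_conference_iff[OF G])
  show "p_energy p (seidel_matrix G vs) = Max (seidel_energies p n) \<longleftrightarrow>
      symmetric_conference_matrix n (seidel_matrix G vs)"
    if "\<exists>S. symmetric_conference_matrix n S"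
    using that Max_seidel_energies[OF assms] bound(2) by auto
  show "p_energy p (seidel_matrix G vs) < real n * (real n - 1) powr (p / 2)"
    if "\<nexists>S. symmetric_conference_matrix n S"
    using that bound by (auto simp: less_le)
next
  assume "\<exists>S. symmetric_conference_matrix n S"
  then show "Max (seidel_energies p n) = real n * (real n - 1) powr (p / 2)"
    using Max_seidel_energies[OF assms] by blast
qed

end
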